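(* Let $G$ be a finite simple connected graph that contains a cycle and has at least two vertices of degree one. Then $G$ has an induced tree on at least $\operatorname{g}(G)+1$ vertices.
   Context: The girth $\operatorname{g}(G)$ is the minimum length of a cycle of $G$. An induced tree of $G$ is an induced subgraph $G[S]$, $S\subseteq V(G)$, that is a tree (connected and acyclic). *)

theory Defs
  imports "Graph_Theory.Digraph_Component"
begin

text \<open>
  A finite simple graph is an instance of the locale \<open>graph\<close> of \<open>Graph_Theory\<close>: a finite, loop-free
  digraph without parallel arcs whose adjacency relation is symmetric. Each undirected edge \<open>uv\<close> is
  represented by the two arcs \<open>u \<rightarrow> v\<close> and \<open>v \<rightarrow> u\<close>, so the degree of a vertex is its \<open>out_degree\<close>.

  The library's \<open>cycle\<close> is the directed notion and accepts \<open>u \<rightarrow> v \<rightarrow> u\<close>, which traverses a single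
  undirected edge twice; for the same reason the library's \<open>forest\<close> and \<open>tree\<close> fail for every
  symmetric digraph with an arc. In a graph, excluding the closed walks of length 2
  leaves exactly the cycles of the undirected graph.
\<close>

definition ucycle :: "('a, 'b) pre_digraph \<Rightarrow> 'b awalk \<Rightarrow> bool" where
  "ucycle G p \<longleftrightarrow> pre_digraph.cycle G p \<and> 3 \<le> length p"

text \<open>Only meaningful if \<open>G\<close> contains a cycle.\<close>

definition girth :: "('a, 'b) pre_digraph \<Rightarrow> nat" where
  "girth G = (LEAST n. \<exists>p. ucycle G p \<and> length p = n)"

definition utree :: "('a, 'b) pre_digraph \<Rightarrow> bool" where
  "utree G \<longleftrightarrow> Digraph_Component.connected G \<and> \<not> (\<exists>p. ucycle G p)"

definition induces_tree :: "('a, 'b) pre_digraph \<Rightarrow> 'a set \<Rightarrow> bool" where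
  "induces_tree G S \<longleftrightarrow> S \<subseteq> verts G \<and> utree (G \<restriction> S)"

end

theory Submission
  imports Defs
begin

text \<open>
  Let \<open>u\<close>, \<open>v\<close> be two leaves, \<open>g\<close> the girth, and \<open>T\<close> a maximum induced tree containing \<open>u\<close>;
  suppose \<open>|T| \<le> g\<close>. By maximality a vertex \<open>x\<close> outside \<open>T\<close> with a neighbour in \<open>T\<close> has two of
  them, so it closes a cycle with a path \<open>P\<close> of \<open>T\<close>. This cycle has at least \<open>g\<close> vertices and
  avoids the leaves, whence \<open>T = P \<union> {u}\<close>, \<open>|P| = g - 1\<close> and \<open>v \<notin> T\<close>. Nor is \<open>v\<close> adjacent
  to \<open>T\<close>, so some \<open>x\<close> as above has a neighbour \<open>y\<close> at distance 2 from \<open>T\<close>. Deleting from \<open>T\<close>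
  an end of \<open>P\<close> not adjacent to \<open>u\<close> and adding \<open>x\<close> and \<open>y\<close> gives an induced tree on \<open>g + 1\<close>
  vertices: no path on fewer than \<open>g\<close> vertices has a chord.
\<close>

section \<open>Cycles and induced trees of a symmetric relation\<close>

definition cyclic :: "('a \<Rightarrow> 'a \<Rightarrow> bool) \<Rightarrow> 'a list \<Rightarrow> bool" where
  "cyclic E c \<longleftrightarrow> distinct c \<and> 3 \<le> length c \<and> successively E c \<and> E (last c) (hd c)"

text \<open>Trees are grown by attaching leaves. Since the neighbour is unique in all of
  \<open>T\<close>, no further edge joins \<open>x\<close> to \<open>T\<close>, so the tree is
  induced; and maximality of a tree becomes a statement about numbers of neighbours.\<close>

inductive ind_tree :: "('a \<Rightarrow> 'a \<Rightarrow> bool) \<Rightarrow> 'a set \<Rightarrow> bool" for E where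
  singleton: "ind_tree E {a}"
| insert: "ind_tree E T \<Longrightarrow> x \<notin> T \<Longrightarrow> \<exists>!t. t \<in> T \<and> E x t \<Longrightarrow> ind_tree E (insert x T)"

lemma cyclic_rotate:
  assumes "cyclic E (as @ bs)"
  shows "cyclic E (bs @ as)"
proof (cases "as = [] \<or> bs = []")
  case True
  then show ?thesis using assms by auto
next
  case False
  then show ?thesis using assms
    by (auto simp: cyclic_def successively_append_iff)
qed

text \<open>Rotate the cycle to start at \<open>x\<close>: its second and last vertices are the two
  neighbours, distinct because the length is at least 3. Hence no leaf lies on a cycle.\<close>

lemma cyclic_two_neighbours:
  assumes "cyclic E c" "symp E" "x \<in> set c"
  obtains p q where "p \<in> set c" "q \<in> set c" "p \<noteq> x" "q \<noteq> x" "p \<noteq> q" "E x p" "E x q"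
proof -
  obtain as bs where c: "c = as @ x # bs"
    using assms(3) by (meson split_list)
  define d where "d = bs @ as"
  have cyc: "cyclic E (x # d)"
    using cyclic_rotate[of E as "x # bs"] assms(1) by (simp add: c d_def)
  then obtain p e where d: "d = p # e" and "e \<noteq> []"
    by (cases d; cases "tl d") (auto simp: cyclic_def)
  then have "E x p" "E x (last e)" "p \<noteq> last e" "distinct (x # d)"
    using cyc assms(2) by (auto simp: cyclic_def dest: sympD)
  moreover have "set d \<subseteq> set c" by (auto simp: c d_def)
  moreover have "last e \<in> set d" "p \<in> set d" using \<open>e \<noteq> []\<close> d by auto
  ultimately show thesis
    using that[of p "last e"] by auto
qed

lemma ind_tree_finite: "ind_tree E T \<Longrightarrow> finite T"
  by (induction rule: ind_tree.induct) auto

text \<open>The vertex attached last has one neighbour in the rest of the tree but would need two on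
  a cycle, so the cycle would already lie in the smaller tree.\<close>

lemma ind_tree_acyclic:
  assumes "ind_tree E T" "symp E" "cyclic E c"
  shows "\<not> set c \<subseteq> T"
  using assms(1)
proof induction
  case (singleton a)
  then show ?case
    using cyclic_two_neighbours[OF assms(3,2)] assms(3)
    by (metis cyclic_def list.set_sel(1) list.size(3) not_numeral_le_zero singletonD subsetD)
next
  case (insert T x)
  show ?case
  proof
    assume sub: "set c \<subseteq> insert x T"
    then have "x \<in> set c" using insert by auto
    then obtain p q where "p \<in> set c" "q \<in> set c" "p \<noteq> x" "q \<noteq> x" "p \<noteq> q" "E x p" "E x q"
      using cyclic_two_neighbours[OF assms(3,2)] by metis
    then show False using sub insert by blast
  qed
qed

lemma ind_tree_path:
  assumes "ind_tree E T" "symp E" "p \<in> T" "q \<in> T"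
  shows "\<exists>P. P \<noteq> [] \<and> distinct P \<and> successively E P \<and> set P \<subseteq> T \<and> hd P = p \<and> last P = q"
  using assms(1,3,4)
proof (induction arbitrary: p q)
  case (singleton a)
  then show ?case by (intro exI[of _ "[a]"]) auto
next
  case (insert T x)
  obtain t where t: "t \<in> T" "E x t" using insert by blast
  then have "E t x" using assms(2) by (auto dest: sympD)
  consider "p \<in> T" "q \<in> T" | "p = x" "q = x" | "p = x" "q \<in> T" | "p \<in> T" "q = x"
    using insert by auto
  then show ?case
  proof cases
    case 1
    then show ?thesis using insert.IH[OF 1] by (metis subset_insertI2)
  next
    case 2
    then show ?thesis by (intro exI[of _ "[x]"]) auto
  next
    case 3
    then obtain P where "P \<noteq> []" "distinct P" "successively E P" "set P \<subseteq> T" "hd P = t" "last P = q"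
      using insert.IH t by metis
    then show ?thesis using t 3 insert.hyps
      by (intro exI[of _ "x # P"]) (auto simp: successively_Cons)
  next
    case 4
    then obtain P where "P \<noteq> []" "distinct P" "successively E P" "set P \<subseteq> T" "hd P = p" "last P = t"
      using insert.IH t by metis
    then show ?thesis using \<open>E t x\<close> 4 insert.hyps
      by (intro exI[of _ "P @ [x]"]) (auto simp: successively_append_iff)
  qed
qed

lemma ind_tree_neighbour:
  assumes "ind_tree E T" "symp E" "a \<in> T" "T \<noteq> {a}"
  shows "\<exists>b\<in>T. E a b"
proof -
  obtain q where "q \<in> T" "q \<noteq> a" using assms by blast
  then obtain P where "P \<noteq> []" "successively E P" "set P \<subseteq> T" "hd P = a" "last P = q"
    using ind_tree_path[OF assms(1-3)] by metis
  moreover from this \<open>q \<noteq> a\<close> obtain b R where "P = a # b # R"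
    by (metis last_ConsL list.collapse)
  ultimately show ?thesis by auto
qed

text \<open>Build the path from its last vertex backwards. Each new vertex sees only its successor,
  since a chord would close a cycle on at most \<open>length P\<close> vertices.\<close>

lemma ind_tree_short_path:
  assumes "symp E" "P \<noteq> []" "distinct P" "successively E P"
    and "\<And>c. cyclic E c \<Longrightarrow> length P < length c"
  shows "ind_tree E (set P)"
  using assms(2-)
proof (induction P)
  case Nil
  then show ?case by simp
next
  case (Cons a P)
  show ?case
  proof (cases P)
    case Nil
    then show ?thesis by (simp add: ind_tree.singleton)
  next
    case P: (Cons b R)
    have "length P < length c" if "cyclic E c" for c
      using Cons.prems(4)[OF that] by simp
    then have tree: "ind_tree E (set P)"
      using Cons.IH Cons.prems(2,3) P by simp
    have "\<exists>!t. t \<in> set P \<and> E a t"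
    proof (intro ex1I[of _ b] conjI)
      show "b \<in> set P" "E a b" using P Cons.prems by auto
      fix t assume t: "t \<in> set P \<and> E a t"
      show "t = b"
      proof (rule ccontr)
        assume "t \<noteq> b"
        then obtain bs cs where R: "R = bs @ t # cs"
          using t P by (auto dest: split_list)
        moreover have "E t a" using t assms(1) by (auto dest: sympD)
        ultimately have "cyclic E (a # b # bs @ [t])"
          using Cons.prems P by (auto simp: cyclic_def successively_Cons successively_append_iff hd_append)
        then show False using Cons.prems(4) P R by fastforce
      qed
    qed
    moreover have "a \<notin> set P" using Cons.prems by simp
    ultimately have "ind_tree E (insert a (set P))" using tree by (intro ind_tree.insert)
    then show ?thesis by simp
  qed
qed

section \<open>The extremal argument for a maximum induced tree through a leaf\<close>

lemma large_ind_tree: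
  assumes sym: "symp E" and irrefl: "irreflp E" and fin: "finite V"
    and EV: "\<And>a b. E a b \<Longrightarrow> a \<in> V \<and> b \<in> V"
    and conn: "\<And>A. A \<noteq> {} \<Longrightarrow> A \<subset> V \<Longrightarrow> \<exists>a\<in>A. \<exists>b\<in>V - A. E a b"
    and girth: "\<And>c. cyclic E c \<Longrightarrow> g \<le> length c"
    and cyc: "cyclic E c" and g: "3 \<le> g"
    and uv: "\<exists>!w. E u w" "\<exists>!w. E v w" "u \<noteq> v"
  shows "\<exists>S. ind_tree E S \<and> S \<subseteq> V \<and> g + 1 \<le> card S"
proof (rule ccontr)
  assume "\<not> ?thesis"
  then have small: "card S \<le> g" if "ind_tree E S" "S \<subseteq> V" for S
    using that by (metis Suc_eq_plus1 not_less_eq_eq)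
  have leaf: "w \<notin> set d" if "\<exists>!z. E w z" "cyclic E d" for w d
    using cyclic_two_neighbours[OF that(2) sym] that(1) by metis
  have uV: "u \<in> V" and vV: "v \<in> V" using uv EV by blast+
  let ?P = "\<lambda>S. ind_tree E S \<and> S \<subseteq> V \<and> u \<in> S"
  have "?P {u}" using uV by (simp add: ind_tree.singleton)
  then obtain T where T: "?P T" and max: "\<And>S. ?P S \<Longrightarrow> card S \<le> card T"
    using ex_has_greatest_nat[of ?P "{u}" card "Suc (card V)"] card_mono[OF fin]
    by (simp add: less_Suc_eq_le) blast
  then have tree: "ind_tree E T" and TV: "T \<subseteq> V" and uT: "u \<in> T" by auto
  have finT: "finite T" using ind_tree_finite[OF tree] .
  \<comment> \<open>Such an \<open>x\<close> could be attached to \<open>T\<close> as a leaf, giving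
    a larger tree containing \<open>u\<close>.\<close>
  have maximal: "\<not> (\<exists>!t. t \<in> T \<and> E x t)" if "x \<notin> T" for x
  proof
    assume ex: "\<exists>!t. t \<in> T \<and> E x t"
    then have "x \<in> V" using EV by blast
    then have "card (insert x T) \<le> card T"
      using ind_tree.insert[OF tree that ex] max TV uT by blast
    then show False using that finT by simp
  qed
  \<comment> \<open>A path \<open>P\<close> of \<open>T\<close> between two neighbours of
    \<open>x\<close> closes a cycle, which misses both leaves. So \<open>g \<le> length P + 1 = card
    (insert u (set P)) \<le> card T \<le> g\<close>, with equality throughout.\<close>
  have struct: "\<exists>P. distinct P \<and> successively E P \<and> T = insert u (set P) \<and> u \<notin> set P \<and> v \<notin> set P
      \<and> length P + 1 = g \<and> E x (hd P) \<and> E x (last P)"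
    if x: "x \<notin> T" "t \<in> T" "E x t" for x t
  proof -
    obtain p q where pq: "p \<in> T" "q \<in> T" "p \<noteq> q" "E x p" "E x q"
      using maximal[OF x(1)] x by blast
    then obtain P where P: "P \<noteq> []" "distinct P" "successively E P" "set P \<subseteq> T" "hd P = p" "last P = q"
      using ind_tree_path[OF tree sym] by metis
    then obtain z R where "P = p # z # R"
      using pq(3) by (metis last_ConsL list.collapse)
    then have "2 \<le> length P" by simp
    then have cyc: "cyclic E (x # P)"
      using P pq x(1) sym by (auto simp: cyclic_def successively_Cons dest: sympD)
    then have "u \<notin> set P" "v \<notin> set P" using leaf[OF uv(1) cyc] leaf[OF uv(2) cyc] by auto
    have card: "card (insert u (set P)) = length P + 1"
      using P \<open>u \<notin> set P\<close> by (simp add: distinct_card)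
    have sub: "insert u (set P) \<subseteq> T" using uT P by simp
    have "card T \<le> card (insert u (set P))"
      using small[OF tree TV] girth[OF cyc] card by simp
    then have "T = insert u (set P)" using card_seteq[OF finT sub] by simp
    moreover from this have "length P + 1 = g"
      using small[OF tree TV] girth[OF cyc] card by simp
    ultimately show ?thesis using P pq \<open>u \<notin> set P\<close> \<open>v \<notin> set P\<close> by blast
  qed
  \<comment> \<open>\<open>V\<close> contains a cycle and \<open>T\<close> does not, so the cut
    condition \<open>conn\<close> applies to \<open>T\<close> and yields a first \<open>x\<close>
    for \<open>struct\<close>.\<close>
  have "set c \<subseteq> V"
    using cyclic_two_neighbours[OF cyc sym] EV by (metis subsetI)
  then have "T \<noteq> V" using ind_tree_acyclic[OF tree sym cyc] by blast
  then obtain t x where "t \<in> T" "x \<in> V - T" "E t x" using conn[of T] TV uT by blast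
  then have "v \<notin> T" using struct[of x t] sym uv by (auto dest: sympD)
  \<comment> \<open>\<open>A\<close> is the closed neighbourhood of \<open>T\<close>. It misses
    \<open>v\<close>: the only neighbour of \<open>v\<close> cannot be in \<open>T\<close>, by
    \<open>maximal\<close>. An edge leaving \<open>A\<close> must start outside
    \<open>T\<close>.\<close>
  define A where "A = T \<union> {x. \<exists>t\<in>T. E x t}"
  have "v \<notin> A" using \<open>v \<notin> T\<close> maximal[of v] uv(2) by (auto simp: A_def)
  moreover have "A \<subseteq> V" using EV TV by (auto simp: A_def)
  moreover have "A \<noteq> {}" using uT by (auto simp: A_def)
  ultimately obtain x y where xy: "x \<in> A" "y \<in> V" "y \<notin> A" "E x y"
    using conn[of A] vV by blast
  then have yx: "E y x" using sym by (auto dest: sympD)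
  then have xT: "x \<notin> T" using xy by (auto simp: A_def)
  then obtain t where "t \<in> T" "E x t" using xy by (auto simp: A_def)
  then obtain P where P: "distinct P" "successively E P" "T = insert u (set P)" "u \<notin> set P"
      "length P + 1 = g" "E x (hd P)" "E x (last P)"
    using struct[OF xT] by blast
  have len: "2 \<le> length P" using P g by simp
  then have "T \<noteq> {u}" using P by (cases P) auto
  then obtain w where w: "w \<in> T" "E u w" using ind_tree_neighbour[OF tree sym uT] by blast
  \<comment> \<open>The head of \<open>Q\<close> will be deleted, so it must not be the neighbour
    \<open>w\<close> of \<open>u\<close>. The ends of \<open>P\<close> differ and are both adjacent
    to \<open>x\<close>, so reversing \<open>P\<close> if necessary suffices.\<close>
  have "\<exists>Q. distinct Q \<and> successively E Q \<and> set Q = set P \<and> length Q = length P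
      \<and> E x (last Q) \<and> hd Q \<noteq> w"
  proof (cases "hd P = w")
    case True
    have "hd P \<noteq> last P" using P len by (cases P) auto
    moreover have "successively E (rev P)"
      using P(2) sympD[OF sym] by (simp add: successively_mono[of E P "\<lambda>x y. E y x"])
    ultimately show ?thesis using P True
      by (intro exI[of _ "rev P"]) (auto simp: hd_rev last_rev)
  qed (use P in blast)
  then obtain p R where Q: "distinct (p # R)" "successively E (p # R)" "set (p # R) = set P"
     "length (p # R) = length P" "E x (last (p # R))" "p \<noteq> w"
    using len by (metis list.sel(1) list.size(3) neq_Nil_conv not_numeral_le_zero)
  have "R \<noteq> []" using Q len by auto
  have RT: "set R \<subseteq> T" "u \<notin> set R" using P Q by auto
  have xu: "x \<noteq> u" using xT uT by blast
  have yT: "y \<notin> T" "\<And>t. t \<in> T \<Longrightarrow> \<not> E y t" using xy by (auto simp: A_def)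
  have "y \<noteq> x" using xy by blast
  \<comment> \<open>With \<open>p\<close> deleted, this path has \<open>g - 1\<close> vertices, too
    few to have a chord.\<close>
  have "ind_tree E (set (R @ [x]))"
  proof (rule ind_tree_short_path[OF sym])
    have "E (last R) x" using Q(5) \<open>R \<noteq> []\<close> sympD[OF sym] by simp
    then show "successively E (R @ [x])" using Q(2) \<open>R \<noteq> []\<close>
      by (simp add: successively_append_iff successively_Cons)
    show "distinct (R @ [x])" using Q RT xT by auto
    show "length (R @ [x]) < length d" if "cyclic E d" for d
      using girth[OF that] Q P by simp
  qed simp
  moreover have "u \<notin> set (R @ [x])" using RT xu by simp
  \<comment> \<open>The leaf \<open>u\<close> hangs on \<open>w\<close>, which lies on
    \<open>P\<close> and survives the deletion because \<open>p \<noteq> w\<close>.\<close>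
  moreover have "\<exists>!t. t \<in> set (R @ [x]) \<and> E u t"
  proof (intro ex1I[of _ w] conjI)
    have "w \<noteq> u" using w(2) irreflpD[OF irrefl] by blast
    then have "w \<in> set (p # R)" using w(1) P(3) Q(3) by blast
    then show "w \<in> set (R @ [x])" using Q(6) by simp
  qed (use w(2) uv(1) in blast)+
  ultimately have 1: "ind_tree E (insert u (set (R @ [x])))" by (rule ind_tree.insert)
  have 2: "y \<notin> insert u (set (R @ [x]))" using yT(1) \<open>y \<noteq> x\<close> RT(1) uT by auto
  have "\<exists>!t. t \<in> insert u (set (R @ [x])) \<and> E y t"
    using yx yT(2) RT(1) uT by (intro ex1I[of _ x]) auto
  then have "ind_tree E (insert y (insert u (set (R @ [x]))))"
    by (rule ind_tree.insert[OF 1 2])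
  moreover have "insert y (insert u (set (R @ [x]))) \<subseteq> V"
    using TV RT(1) uV xy(2) EV[OF xy(4)] by auto
  \<comment> \<open>The \<open>g - 2\<close> vertices of \<open>R\<close> together with
    \<open>x\<close>, \<open>u\<close> and \<open>y\<close> make \<open>g + 1\<close>.\<close>
  ultimately have "card (insert y (insert u (set (R @ [x])))) \<le> g" by (rule small)
  moreover have "card (set (R @ [x])) = length R + 1"
    using Q(1) RT(1) xT by (subst distinct_card) auto
  ultimately show False using 2 RT(2) xu Q(4) P(5) by simp
qed

section \<open>Translation between arc walks of a digraph and vertex lists\<close>

lemma (in wf_digraph) cas_imp_successively:
  "cas u p v \<Longrightarrow> set p \<subseteq> arcs G \<Longrightarrow>
    successively (\<lambda>a b. a \<rightarrow> b) (u # map (head G) p) \<and> last (u # map (head G) p) = v"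
  by (induction p arbitrary: u) (auto intro: in_arcs_imp_in_arcs_ends)

lemma (in wf_digraph) successively_imp_awalk:
  assumes "successively (\<lambda>a b. a \<rightarrow> b) (u # c)" "u \<in> verts G"
  shows "\<exists>p. awalk u p (last (u # c)) \<and> map (head G) p = c"
  using assms
proof (induction c arbitrary: u)
  case Nil
  then show ?case by (auto simp: awalk_def)
next
  case (Cons v c)
  then obtain e where e: "e \<in> arcs G" "tail G e = u" "head G e = v" by auto
  moreover obtain p where "awalk v p (last (v # c))" "map (head G) p = c"
    using Cons.IH[of v] Cons.prems e by auto
  ultimately show ?case
    by (intro exI[of _ "e # p"]) (auto simp: awalk_def)
qed

lemma (in wf_digraph) ucycle_imp_cyclic:
  assumes "ucycle G p"
  shows "cyclic (\<lambda>a b. a \<rightarrow> b) (map (head G) p)"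
proof -
  obtain u where u: "awalk u p u" "distinct (tl (awalk_verts u p))" "3 \<le> length p"
    using assms by (auto simp: ucycle_def cycle_def)
  moreover have "p \<noteq> []" using u by auto
  ultimately show ?thesis
    using cas_imp_successively[of u p u] awalk_verts_conv'[of u p u]
    by (cases p) (auto simp: cyclic_def awalk_def)
qed

lemma (in wf_digraph) cyclic_imp_ucycle:
  assumes "cyclic (\<lambda>a b. a \<rightarrow> b) c"
  shows "\<exists>p. ucycle G p \<and> length p = length c"
proof -
  \<comment> \<open>The walk starts at \<open>last c\<close>, so that the heads of its arcs spell
    out exactly \<open>c\<close>.\<close>
  have c: "c \<noteq> []" "successively (\<lambda>a b. a \<rightarrow> b) (last c # c)" "last c \<in> verts G"
    using assms by (auto simp: cyclic_def successively_Cons intro: adj_in_verts)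
  then obtain p where p: "awalk (last c) p (last c)" "map (head G) p = c"
    using successively_imp_awalk[OF c(2,3)] by auto
  moreover from p c have "p \<noteq> []" by auto
  moreover from p have "length p = length c" by auto
  ultimately show ?thesis
    using assms awalk_verts_conv'[of "last c" p "last c"]
    by (intro exI[of _ p]) (auto simp: ucycle_def cycle_def cyclic_def awalk_def)
qed

text \<open>Connectedness is defined through the symmetric closure, which leaves reachability in a
  symmetric digraph unchanged.\<close>

lemma (in sym_digraph) connected_iff_reachable:
  "Digraph_Component.connected G \<longleftrightarrow> verts G \<noteq> {} \<and> (\<forall>u\<in>verts G. \<forall>v\<in>verts G. u \<rightarrow>\<^sup>* v)"
  using reachable_mk_symmetric_eq[OF sym_arcs]
  by (simp add: Digraph_Component.connected_def strongly_connected_def)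

lemma (in wf_digraph) reachable_leaves_set:
  assumes "u \<rightarrow>\<^sup>* v" "u \<in> A" "v \<notin> A"
  shows "\<exists>a\<in>A. \<exists>b\<in>verts G - A. a \<rightarrow> b"
  using assms
  by (induction rule: reachable_induct) (auto intro: adj_in_verts)

text \<open>Without parallel arcs \<open>head G\<close> is injective on the arcs leaving
  \<open>v\<close>, so the out-degree counts neighbours.\<close>

lemma (in nomulti_digraph) out_degree_1_iff:
  "out_degree G v = 1 \<longleftrightarrow> (\<exists>!w. v \<rightarrow> w)"
proof -
  have "out_degree G v = card (head G ` out_arcs G v)"
    unfolding out_degree_def
    by (rule card_image[symmetric]) (auto simp: inj_on_def arc_to_ends_def intro: no_multi_arcs)
  also have "head G ` out_arcs G v = {w. v \<rightarrow> w}"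
    by (auto simp: arcs_ends_conv)
  finally show ?thesis by (auto simp: card_1_singleton_iff Ex1_def)
qed

lemma (in sym_digraph) ind_tree_imp_induces_tree:
  assumes "ind_tree (\<lambda>a b. a \<rightarrow> b) S" "S \<subseteq> verts G"
  shows "induces_tree G S"
proof -
  have sym: "symp (\<lambda>a b. a \<rightarrow> b)" using graph_symmetric by (auto intro: sympI)
  have adj: "a \<rightarrow>\<^bsub>G \<restriction> S\<^esub> b \<longleftrightarrow> a \<in> S \<and> b \<in> S \<and> a \<rightarrow> b" for a b
    by (auto simp: arcs_ends_conv)
  have "symmetric (G \<restriction> S)"
    unfolding symmetric_def by (rule symI) (simp add: adj graph_symmetric)
  then interpret S: sym_digraph "G \<restriction> S"
    using wellformed_induce_subgraph by (rule wf_digraph.sym_digraphI[rotated])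
  have "u \<rightarrow>\<^sup>*\<^bsub>G \<restriction> S\<^esub> v" if uv: "u \<in> S" "v \<in> S" for u v
  proof -
    obtain P where "P \<noteq> []" "successively (\<lambda>a b. a \<rightarrow> b) P" "set P \<subseteq> S" "hd P = u" "last P = v"
      using ind_tree_path[OF assms(1) sym uv] by metis
    then show ?thesis
    proof (induction P arbitrary: u)
      case Nil
      then show ?case by simp
    next
      case (Cons a P)
      show ?case
      proof (cases "P = []")
        case False
        then have "u \<rightarrow>\<^bsub>G \<restriction> S\<^esub> hd P" "hd P \<rightarrow>\<^sup>*\<^bsub>G \<restriction> S\<^esub> v"
          using Cons by (auto simp: adj successively_Cons)
        then show ?thesis by (rule S.adj_reachable_trans)
      qed (use Cons in auto)
    qed
  qed
  moreover have "S \<noteq> {}" using assms(1) by cases auto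
  ultimately have "Digraph_Component.connected (G \<restriction> S)"
    by (simp add: S.connected_iff_reachable)
  moreover have "\<not> ucycle (G \<restriction> S) p" for p
  proof
    assume p: "ucycle (G \<restriction> S) p"
    let ?c = "map (head (G \<restriction> S)) p"
    have c: "cyclic (\<lambda>a b. a \<rightarrow>\<^bsub>G \<restriction> S\<^esub> b) ?c"
      by (rule S.ucycle_imp_cyclic[OF p])
    then have "cyclic (\<lambda>a b. a \<rightarrow> b) ?c"
      unfolding cyclic_def by (auto simp: adj intro: successively_mono)
    \<comment> \<open>Each vertex of the cycle has a neighbour in \<open>G \<restriction> S\<close>,
      whose arcs have both ends in \<open>S\<close>.\<close>
    moreover have "set ?c \<subseteq> S"
    proof
      fix x assume "x \<in> set ?c"
      then obtain y where "x \<rightarrow>\<^bsub>G \<restriction> S\<^esub> y"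
        using cyclic_two_neighbours[OF c] S.graph_symmetric by (metis (no_types, lifting) sympI)
      then show "x \<in> S" by (simp add: adj)
    qed
    ultimately show False using ind_tree_acyclic[OF assms(1) sym] by blast
  qed
  ultimately show ?thesis using assms(2) by (simp add: induces_tree_def utree_def)
qed

theorem lemma4p2:
  fixes G :: "('a, 'b) pre_digraph"
  assumes "Digraph.graph G"
    and "Digraph_Component.connected G"
    and "\<exists>p. ucycle G p"
    and "2 \<le> card {v \<in> verts G. out_degree G v = 1}"
  shows "\<exists>S. induces_tree G S \<and> girth G + 1 \<le> card S"
proof -
  interpret graph G by fact
  let ?E = "\<lambda>a b. a \<rightarrow>\<^bsub>G\<^esub> b"
  \<comment> \<open>A shortest cycle: it serves as the required cycle and also shows
    \<open>3 \<le> girth G\<close>.\<close>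
  obtain p where p: "ucycle G p" "length p = girth G"
    using LeastI_ex[of "\<lambda>n. \<exists>p. ucycle G p \<and> length p = n"] assms(3)
    unfolding girth_def by blast
  have girth: "girth G \<le> length c" if "cyclic ?E c" for c
    using cyclic_imp_ucycle[OF that] unfolding girth_def by (auto intro: Least_le)
  obtain L where L: "L \<subseteq> {v \<in> verts G. out_degree G v = 1}" "card L = 2"
    using obtain_subset_with_card_n[OF assms(4)] by metis
  then obtain u v where uv: "L = {u, v}" "u \<noteq> v" by (auto simp: card_2_iff)
  then have leaves: "\<exists>!w. ?E u w" "\<exists>!w. ?E v w"
    using L by (auto simp: out_degree_1_iff[symmetric] simp del: One_nat_def)
  have cut: "\<exists>a\<in>A. \<exists>b\<in>verts G - A. ?E a b" if "A \<noteq> {}" "A \<subset> verts G" for A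
  proof -
    obtain a b where "a \<in> A" "b \<in> verts G" "b \<notin> A" using \<open>A \<noteq> {}\<close> \<open>A \<subset> verts G\<close> by blast
    then show ?thesis
      using reachable_leaves_set[of a b A] assms(2) \<open>A \<subset> verts G\<close>
      by (auto simp: connected_iff_reachable)
  qed
  have "\<exists>S. ind_tree ?E S \<and> S \<subseteq> verts G \<and> girth G + 1 \<le> card S"
  proof (rule large_ind_tree[OF _ _ _ _ cut girth ucycle_imp_cyclic[OF p(1)] _ leaves uv(2)])
    show "symp ?E" using graph_symmetric by (auto intro: sympI)
    show "irreflp ?E" using adj_not_same by (auto intro: irreflpI)
    show "3 \<le> girth G" using p by (simp add: ucycle_def)
    show "a \<in> verts G \<and> b \<in> verts G" if "?E a b" for a b using that by (auto intro: adj_in_verts)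
  qed auto
  then show ?thesis using ind_tree_imp_induces_tree by blast
qed

end
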